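(* $$\delta_{1,1}(G_\infty) > \delta_{2,3}(G_\infty).$$
   Context: $G_\infty$ denotes the infinite grid: the graph with vertex set $\mathbb{Z}\times\mathbb{Z}$ in which two vertices are adjacent if and only if they are at Euclidean distance $1$. $dist(\cdot,\cdot)$ is the graph distance (so $dist((a,b),(c,d))=|a-c|+|b-d|$). Let $t,r$ be positive integers. For a set of vertices $\mathbb{T}\subseteq \mathbb{Z}\times\mathbb{Z}$ (whose elements are called towers, of signal strength $t$), the signal a vertex $v$ receives from a tower $T\in\mathbb{T}$ is $sig(v,T)=\min(\max(t-dist(v,T),0),r)$, and the total signal at $v$ is $sig(v)=\sum_{T\in\mathbb{T}} sig(v,T)$. The set $\mathbb{T}$ is a $(t,r)$ broadcast on $G_\infty$ if $sig(v)\geq r$ for every vertex $v$. (Omitting the truncation at $r$ in the definition of signal gives the same notion of broadcast.) The broadcast density of $\mathbb{T}$ is $\lim_{n\to\infty} \frac{|\mathbb{T}\cap V_n|}{|V_n|}$, where $V_n=\{-n,\dots,n\}\times\{-n,\dots,n\}$. The optimal density $\delta_{t,r}(G_\infty)$ is the minimum broadcast density over all $(t,r)$ broadcasts on $G_\infty$ (among those for which the limit exists). *)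

theory Defs
  imports "HOL-Analysis.Analysis"
begin

type_synonym vertex = "int \<times> int"

definition grid_edges :: "(vertex \<times> vertex) set" where
  "grid_edges = {((a, b), (c, d)).
     dist (real_of_int a, real_of_int b) (real_of_int c, real_of_int d) = 1}"

definition grid_dist :: "vertex \<Rightarrow> vertex \<Rightarrow> nat" where
  "grid_dist u v = (LEAST n. (u, v) \<in> grid_edges ^^ n)"

definition signal :: "nat \<Rightarrow> nat \<Rightarrow> vertex \<Rightarrow> vertex \<Rightarrow> real" where
  "signal t r v T = min (max (real t - real (grid_dist v T)) 0) (real r)"

(* Only the finitely many towers at distance less than t from v contribute;
   see signal_summable below. *)
definition total_signal :: "nat \<Rightarrow> nat \<Rightarrow> vertex set \<Rightarrow> vertex \<Rightarrow> real" where
  "total_signal t r \<T> v = (\<Sum>\<^sub>\<infinity>T\<in>\<T>. signal t r v T)"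

definition broadcast :: "nat \<Rightarrow> nat \<Rightarrow> vertex set \<Rightarrow> bool" where
  "broadcast t r \<T> \<longleftrightarrow> (\<forall>v. total_signal t r \<T> v \<ge> real r)"

definition grid_box :: "nat \<Rightarrow> vertex set" where
  "grid_box n = {- int n..int n} \<times> {- int n..int n}"

definition has_broadcast_density :: "vertex set \<Rightarrow> real \<Rightarrow> bool" where
  "has_broadcast_density \<T> d \<longleftrightarrow>
     (\<lambda>n. real (card (\<T> \<inter> grid_box n)) / real (card (grid_box n))) \<longlonglongrightarrow> d"

(* A genuine minimum rather than an infimum: if no (t, r) broadcast attains a
   least density, the value is unspecified. *)
definition optimal_density :: "nat \<Rightarrow> nat \<Rightarrow> real" where
  "optimal_density t r = (LEAST d. \<exists>\<T>. broadcast t r \<T> \<and> has_broadcast_density \<T> d)"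

lemma grid_edges_iff:
  "((a, b), (c, d)) \<in> grid_edges \<longleftrightarrow> \<bar>a - c\<bar> + \<bar>b - d\<bar> = 1"
proof -
  have "((a, b), (c, d)) \<in> grid_edges \<longleftrightarrow> (real_of_int (a - c))\<^sup>2 + (real_of_int (b - d))\<^sup>2 = 1"
    by (simp add: grid_edges_def dist_Pair_Pair dist_real_def)
  also have "\<dots> \<longleftrightarrow> (a - c)\<^sup>2 + (b - d)\<^sup>2 = 1"
    by (metis (mono_tags, opaque_lifting) of_int_add of_int_eq_1_iff of_int_power)
  also have "\<dots> \<longleftrightarrow> \<bar>a - c\<bar> + \<bar>b - d\<bar> = 1"
  proof -
    have sq: "x\<^sup>2 = 0 \<and> x = 0 \<or> x\<^sup>2 = 1 \<and> \<bar>x\<bar> = 1 \<or> x\<^sup>2 > 1 \<and> \<bar>x\<bar> > 1" for x :: int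
    proof -
      consider "x = 0" | "\<bar>x\<bar> = 1" | "\<bar>x\<bar> > 1" by linarith
      then show ?thesis
      proof cases
        case 3
        then have "1 < \<bar>x\<bar> ^ 2" by (intro one_less_power) auto
        with 3 show ?thesis by simp
      qed (auto simp: abs_if split: if_splits)
    qed
    show ?thesis using sq[of "a - c"] sq[of "b - d"] by auto
  qed
  finally show ?thesis .
qed

lemma grid_relpow_lower:
  "((a, b), (c, d)) \<in> grid_edges ^^ n \<Longrightarrow> \<bar>a - c\<bar> + \<bar>b - d\<bar> \<le> int n"
proof (induction n arbitrary: c d)
  case (Suc n)
  then obtain e f where "((a, b), (e, f)) \<in> grid_edges ^^ n" "((e, f), (c, d)) \<in> grid_edges"
    by auto
  with Suc.IH[of e f] show ?case by (auto simp: grid_edges_iff)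
qed auto

lemma grid_relpow_upper:
  "int n = \<bar>a - c\<bar> + \<bar>b - d\<bar> \<Longrightarrow> ((a, b), (c, d)) \<in> grid_edges ^^ n"
proof (induction n arbitrary: c d)
  case (Suc n)
  obtain e f where "int n = \<bar>a - e\<bar> + \<bar>b - f\<bar>" "\<bar>e - c\<bar> + \<bar>f - d\<bar> = 1"
  proof -
    consider "a < c" | "c < a" | "a = c" "b < d" | "a = c" "d < b"
      using Suc.prems by fastforce
    then show thesis
    proof cases
      case 1 with Suc.prems that[of "c - 1" d] show thesis by auto
    next
      case 2 with Suc.prems that[of "c + 1" d] show thesis by auto
    next
      case 3 with Suc.prems that[of c "d - 1"] show thesis by auto
    next
      case 4 with Suc.prems that[of c "d + 1"] show thesis by auto
    qed
  qed
  with Suc.IH[of e f] show ?case by (auto simp: grid_edges_iff)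
qed auto

lemma grid_dist_eq: "int (grid_dist (a, b) (c, d)) = \<bar>a - c\<bar> + \<bar>b - d\<bar>"
proof -
  have "grid_dist (a, b) (c, d) = nat (\<bar>a - c\<bar> + \<bar>b - d\<bar>)"
    unfolding grid_dist_def
    by (rule Least_equality) (auto intro: grid_relpow_upper dest: grid_relpow_lower)
  then show ?thesis by simp
qed

lemma signal_summable: "signal t r v summable_on \<T>"
proof -
  obtain a b where v: "v = (a, b)" by fastforce
  let ?S = "{a - int t..a + int t} \<times> {b - int t..b + int t}"
  have "signal t r v T = 0" if "T \<notin> ?S" for T
  proof -
    obtain c d where T: "T = (c, d)" by fastforce
    have "int t \<le> int (grid_dist v T)"
      using that unfolding v T grid_dist_eq by auto
    then show ?thesis by (simp add: signal_def)
  qed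
  then have "signal t r v summable_on \<T> \<longleftrightarrow> signal t r v summable_on (\<T> \<inter> ?S)"
    by (intro summable_on_cong_neutral) auto
  then show ?thesis by (simp add: summable_on_finite)
qed

end

theory Submission
  imports Defs "HOL-Real_Asymp.Real_Asymp"
begin

text \<open>
  The two optimal densities are \<open>1\<close> and \<open>1/2\<close>.

  A tower of strength \<open>1\<close> is heard only at its own vertex, so the set of all vertices is the only
  \<open>(1,1)\<close> broadcast (lemma \<open>broadcast_1_1_iff\<close>).

  A tower of strength \<open>2\<close> emits \<open>2\<close> at its own vertex and \<open>1\<close> at each of its four neighbours, that
  is \<open>6\<close> in total, whereas every vertex has to receive \<open>3\<close>. Double counting the signal received
  inside a box therefore bounds the density of a \<open>(2,3)\<close> broadcast below by \<open>1/2\<close>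
  (lemma \<open>broadcast_2_3_card_bound\<close>). The bound is attained when no signal is wasted, that is, when
  every tower has exactly one tower and every other vertex exactly three towers among its
  neighbours. To achieve this, tile the plane with horizontal dominoes stacked in columns, colour
  them so that dominoes adjacent in a row or in a column have opposite colours, and put the towers
  on one colour: each vertex then has exactly one neighbour of its own colour
  (lemma \<open>broadcast_2_3_dominoes\<close>).
\<close>

lemma signal_eq:
  "signal t r (a, b) (c, d)
     = min (max (real t - real_of_int (\<bar>a - c\<bar> + \<bar>b - d\<bar>)) 0) (real r)"
proof -
  have "real (grid_dist (a, b) (c, d)) = real_of_int (\<bar>a - c\<bar> + \<bar>b - d\<bar>)"
    by (metis grid_dist_eq of_int_of_nat_eq)
  then show ?thesis by (simp add: signal_def)
qed

lemma total_signal_eq_sum: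
  assumes "finite S" and "\<And>u. u \<notin> S \<Longrightarrow> signal t r v u = 0"
  shows "total_signal t r \<T> v = (\<Sum>u\<in>S. indicator \<T> u * signal t r v u)"
proof -
  have "total_signal t r \<T> v = (\<Sum>\<^sub>\<infinity>u\<in>S. indicator \<T> u * signal t r v u)"
    unfolding total_signal_def
    using assms(2) by (intro infsum_cong_neutral) (auto simp: indicator_def)
  then show ?thesis using assms(1) by simp
qed

lemma card_symmetric_interval: "card {- int n..int n} = 2 * n + 1"
  by simp

lemma card_grid_box: "card (grid_box n) = (2 * n + 1)\<^sup>2"
  by (simp only: grid_box_def card_cartesian_product card_symmetric_interval power2_eq_square)

lemma real_card_grid_box: "real (card (grid_box n)) = (2 * real n + 1)\<^sup>2"
  by (simp only: card_grid_box of_nat_power of_nat_add of_nat_mult of_nat_numeral of_nat_1)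

lemma finite_grid_box: "finite (grid_box n)"
  by (simp add: grid_box_def)

section \<open>Signal strength and threshold one\<close>

lemma total_signal_1_1: "total_signal 1 1 \<T> v = indicator \<T> v"
proof (cases v)
  case (Pair a b)
  have "signal 1 1 v u = 0" if "u \<notin> {v}" for u
    using that Pair by (cases u) (auto simp: signal_eq)
  then have "total_signal 1 1 \<T> v = (\<Sum>u\<in>{v}. indicator \<T> u * signal 1 1 v u)"
    by (intro total_signal_eq_sum) auto
  also have "\<dots> = indicator \<T> v"
    \<comment> \<open>The deleted rules would rewrite the sum to one over \<open>{v} \<inter> \<T>\<close> before it is expanded.\<close>
    by (simp add: Pair signal_eq
        del: Indicator_Function.sum_indicator_mult Bochner_Integration.sum_indicator_mult)
  finally show ?thesis .
qed

lemma broadcast_1_1_iff: "broadcast 1 1 \<T> \<longleftrightarrow> \<T> = UNIV"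
  by (auto simp: broadcast_def total_signal_1_1[unfolded One_nat_def] indicator_def split: if_splits)

lemma has_broadcast_density_UNIV_iff: "has_broadcast_density UNIV d \<longleftrightarrow> d = 1"
  by (auto simp: has_broadcast_density_def card_grid_box LIMSEQ_const_iff)

lemma optimal_density_1_1: "optimal_density 1 1 = 1"
  unfolding optimal_density_def
  by (rule Least_equality) (auto simp only: broadcast_1_1_iff has_broadcast_density_UNIV_iff)

section \<open>Signal strength two and threshold three: the lower bound\<close>

lemma total_signal_2_3:
  "total_signal 2 3 \<T> (a, b) = 2 * indicator \<T> (a, b) + indicator \<T> (a + 1, b)
     + indicator \<T> (a - 1, b) + indicator \<T> (a, b + 1) + indicator \<T> (a, b - 1)"
proof -
  let ?S = "{(a, b), (a + 1, b), (a - 1, b), (a, b + 1), (a, b - 1)}"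
  have "signal 2 3 (a, b) u = 0" if u: "u \<notin> ?S" for u
  proof (cases u)
    case (Pair c d)
    have "2 \<le> \<bar>a - c\<bar> + \<bar>b - d\<bar>"
      using u Pair by auto
    then have "2 \<le> real_of_int (\<bar>a - c\<bar> + \<bar>b - d\<bar>)"
      by linarith
    then show ?thesis
      unfolding Pair signal_eq by simp
  qed
  then have "total_signal 2 3 \<T> (a, b) = (\<Sum>u\<in>?S. indicator \<T> u * signal 2 3 (a, b) u)"
    by (intro total_signal_eq_sum) auto
  also have "\<dots> = 2 * indicator \<T> (a, b) + indicator \<T> (a + 1, b)
     + indicator \<T> (a - 1, b) + indicator \<T> (a, b + 1) + indicator \<T> (a, b - 1)"
    by (simp add: signal_eq
        del: Indicator_Function.sum_indicator_mult Bochner_Integration.sum_indicator_mult)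
  finally show ?thesis .
qed

lemma sum_indicator_shift_le:
  fixes \<T> :: "vertex set"
  assumes "\<bar>i\<bar> \<le> int k" and "\<bar>j\<bar> \<le> int k"
  shows "(\<Sum>(a, b)\<in>grid_box n. indicator \<T> (a + i, b + j)) \<le> real (card (\<T> \<inter> grid_box (n + k)))"
proof -
  let ?s = "\<lambda>(a, b). (a + i, b + j)"
  have inj: "inj_on ?s (grid_box n)"
    by (auto simp: inj_on_def)
  have sub: "?s ` grid_box n \<subseteq> grid_box (n + k)"
    using assms by (auto simp: grid_box_def)
  have "(\<Sum>(a, b)\<in>grid_box n. indicator \<T> (a + i, b + j))
          = (\<Sum>u\<in>?s ` grid_box n. indicator \<T> u :: real)"
    by (subst sum.reindex[OF inj]) (simp add: case_prod_unfold)
  also have "\<dots> \<le> (\<Sum>u\<in>grid_box (n + k). indicator \<T> u)"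
    by (intro sum_mono2 sub) (auto simp: finite_grid_box)
  also have "\<dots> = real (card (\<T> \<inter> grid_box (n + k)))"
    by (simp add: indicator_def finite_grid_box Int_commute)
  finally show ?thesis .
qed

text \<open>
  Double counting: each vertex of the box of radius \<open>n\<close> receives at least \<open>3\<close>, and this signal
  comes from towers in the box of radius \<open>n + 1\<close>, each of which emits \<open>6\<close>.
\<close>

lemma broadcast_2_3_card_bound:
  assumes "broadcast 2 3 \<T>"
  shows "(2 * real n + 1)\<^sup>2 \<le> 2 * real (card (\<T> \<inter> grid_box (n + 1)))"
proof -
  let ?c = "real (card (\<T> \<inter> grid_box (n + 1)))"
  let ?S = "\<lambda>i j. (\<Sum>(a, b)\<in>grid_box n. indicator \<T> (a + i, b + j)) :: real"
  have le: "?S i j \<le> ?c" if "\<bar>i\<bar> \<le> 1" "\<bar>j\<bar> \<le> 1" for i j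
    using that by (intro sum_indicator_shift_le) auto
  have "3 * (2 * real n + 1)\<^sup>2 = (\<Sum>v\<in>grid_box n. 3)"
    by (simp add: card_grid_box)
  also have "\<dots> \<le> (\<Sum>v\<in>grid_box n. total_signal 2 3 \<T> v)"
    using assms by (intro sum_mono) (auto simp: broadcast_def)
  also have "\<dots> = 2 * ?S 0 0 + ?S 1 0 + ?S (-1) 0 + ?S 0 1 + ?S 0 (-1)"
  proof -
    have "(\<Sum>v\<in>grid_box n. total_signal 2 3 \<T> v)
        = (\<Sum>(a, b)\<in>grid_box n. total_signal 2 3 \<T> (a, b))"
      by simp
    then show ?thesis
      by (simp only: total_signal_2_3 case_prod_unfold sum.distrib sum_distrib_left
          add_0_right diff_conv_add_uminus)
  qed
  also have "\<dots> \<le> 6 * ?c"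
    using le[of 0 0] le[of 1 0] le[of "-1" 0] le[of 0 1] le[of 0 "-1"] by linarith
  finally show ?thesis by simp
qed

lemma broadcast_2_3_ratio_bound:
  assumes "broadcast 2 3 \<T>" and "n > 0"
  shows "(2 * real n - 1)\<^sup>2 / (2 * (2 * real n + 1)\<^sup>2)
           \<le> real (card (\<T> \<inter> grid_box n)) / real (card (grid_box n))"
proof -
  obtain m where n: "n = m + 1"
    using assms(2) by (metis Suc_eq_plus1 gr0_implies_Suc)
  have "(2 * real n - 1)\<^sup>2 \<le> 2 * real (card (\<T> \<inter> grid_box n))"
    using broadcast_2_3_card_bound[OF assms(1), of m] by (simp add: n algebra_simps)
  then have "(2 * real n - 1)\<^sup>2 / (2 * (2 * real n + 1)\<^sup>2)
      \<le> (2 * real (card (\<T> \<inter> grid_box n))) / (2 * (2 * real n + 1)\<^sup>2)"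
    by (intro divide_right_mono) auto
  also have "\<dots> = real (card (\<T> \<inter> grid_box n)) / (2 * real n + 1)\<^sup>2"
    by (rule mult_divide_mult_cancel_left) simp
  finally show ?thesis
    unfolding real_card_grid_box .
qed

lemma ratio_bound_tendsto_half:
  "(\<lambda>n. (2 * real n - 1)\<^sup>2 / (2 * (2 * real n + 1)\<^sup>2)) \<longlonglongrightarrow> 1/2"
  by real_asymp

lemma broadcast_2_3_density_ge_half:
  assumes "broadcast 2 3 \<T>" and "has_broadcast_density \<T> d"
  shows "1/2 \<le> d"
  using ratio_bound_tendsto_half assms(2)[unfolded has_broadcast_density_def]
proof (rule LIMSEQ_le)
  show "\<exists>N. \<forall>n\<ge>N. (2 * real n - 1)\<^sup>2 / (2 * (2 * real n + 1)\<^sup>2)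
      \<le> real (card (\<T> \<inter> grid_box n)) / real (card (grid_box n))"
    by (metis broadcast_2_3_ratio_bound[OF assms(1)] less_le_trans zero_less_one)
qed

section \<open>The domino broadcast\<close>

text \<open>
  Row \<open>y\<close> is cut into the dominoes \<open>{(2 * k, y), (2 * k + 1, y)}\<close>; the towers fill those with
  \<open>k + y\<close> even.
\<close>

definition dominoes :: "vertex set" where
  "dominoes = {(x, y). even (x div 2 + y)}"

lemma broadcast_2_3_dominoes: "broadcast 2 3 dominoes"
  unfolding broadcast_def
proof (clarify)
  fix a b :: int
  obtain k where "a = 2 * k \<or> a = 2 * k + 1"
    by (metis evenE oddE)
  moreover have "(2 * k - 1) div 2 = k - 1" "(2 * k + 2) div 2 = k + 1"
    by auto
  ultimately show "real 3 \<le> total_signal 2 3 dominoes (a, b)"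
    by (cases "even k"; cases "even b")
       (auto simp: total_signal_2_3 dominoes_def indicator_def)
qed

text \<open>Halving is injective on integers of the same parity.\<close>

lemma card_same_parity_le: "card {y \<in> {- int n..int n}. even (c + y)} \<le> n + 1"
proof -
  have "card {y \<in> {- int n..int n}. even (c + y)} \<le> card {0..int n}"
  proof (rule card_inj_on_le)
    show "inj_on (\<lambda>y. (y + int n) div 2) {y \<in> {- int n..int n}. even (c + y)}"
      by (rule inj_onI) (simp, presburger)
  qed auto
  then show ?thesis by simp
qed

lemma card_dominoes_le: "card (dominoes \<inter> grid_box n) \<le> (2 * n + 1) * (n + 1)"
proof -
  have "dominoes \<inter> grid_box n
      = (SIGMA x:{- int n..int n}. {y \<in> {- int n..int n}. even (x div 2 + y)})"
    by (auto simp: dominoes_def grid_box_def)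
  moreover have "card \<dots>
      = (\<Sum>x\<in>{- int n..int n}. card {y \<in> {- int n..int n}. even (x div 2 + y)})"
    by (rule card_SigmaI) (auto intro: rev_finite_subset[of "{- int n..int n}"])
  ultimately have "card (dominoes \<inter> grid_box n)
      = (\<Sum>x\<in>{- int n..int n}. card {y \<in> {- int n..int n}. even (x div 2 + y)})"
    by (rule trans[OF arg_cong])
  also have "\<dots> \<le> card {- int n..int n} * (n + 1)"
    using sum_bounded_above[of "{- int n..int n}" _ "n + 1", OF card_same_parity_le]
    by (simp only: of_nat_id)
  also note card_symmetric_interval
  finally show ?thesis .
qed

text \<open>
  The lower estimate is the one valid for every \<open>(2,3)\<close> broadcast, so only the upper one needs
  counting.
\<close>

lemma has_broadcast_density_dominoes: "has_broadcast_density dominoes (1/2)"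
  unfolding has_broadcast_density_def
proof (rule tendsto_sandwich[OF _ _ ratio_bound_tendsto_half])
  show "\<forall>\<^sub>F n in sequentially. (2 * real n - 1)\<^sup>2 / (2 * (2 * real n + 1)\<^sup>2)
      \<le> real (card (dominoes \<inter> grid_box n)) / real (card (grid_box n))"
    using eventually_gt_at_top[of 0]
    by eventually_elim (rule broadcast_2_3_ratio_bound[OF broadcast_2_3_dominoes])
  have "real (card (dominoes \<inter> grid_box n)) / real (card (grid_box n))
      \<le> (real n + 1) / (2 * real n + 1)" for n
  proof -
    have "real (card (dominoes \<inter> grid_box n)) \<le> real ((2 * n + 1) * (n + 1))"
      using card_dominoes_le of_nat_le_iff by blast
    then have "real (card (dominoes \<inter> grid_box n)) / real (card (grid_box n))
        \<le> real ((2 * n + 1) * (n + 1)) / real (card (grid_box n))"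
      by (intro divide_right_mono) auto
    also have "real ((2 * n + 1) * (n + 1)) = (2 * real n + 1) * (real n + 1)"
      by (simp only: of_nat_mult of_nat_add of_nat_numeral of_nat_1)
    also have "\<dots> / real (card (grid_box n)) = (real n + 1) / (2 * real n + 1)"
      unfolding real_card_grid_box power2_eq_square
      by (rule mult_divide_mult_cancel_left) simp
    finally show ?thesis .
  qed
  then show "\<forall>\<^sub>F n in sequentially. real (card (dominoes \<inter> grid_box n)) / real (card (grid_box n))
      \<le> (real n + 1) / (2 * real n + 1)"
    by simp
  show "(\<lambda>n. (real n + 1) / (2 * real n + 1)) \<longlonglongrightarrow> 1/2"
    by real_asymp
qed

lemma optimal_density_2_3: "optimal_density 2 3 = 1/2"
  unfolding optimal_density_def
  by (rule Least_equality)
     (use broadcast_2_3_dominoes has_broadcast_density_dominoes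
          broadcast_2_3_density_ge_half in blast)+

theorem proposition2: "optimal_density 1 1 > optimal_density 2 3"
  by (simp only: optimal_density_1_1 optimal_density_2_3)

end
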